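(* Let $A$ be a $d\times n$ integer matrix and $B$ a $p\times n$ integer matrix. Then the Graver complexity $g(A,B)$ equals the maximum $1$-norm of any element of the Graver basis $\mathcal{G}(B\cdot\mathcal{G}(A))$.
   Context: For an integer matrix $A$ with $n$ columns, $\ker_{\mathbb{Z}}(A)$ is the set of integer vectors $\mathbf{u}\in\mathbb{Z}^n$ with $A\mathbf{u}=0$. For nonzero vectors $\mathbf{u},\mathbf{v},\mathbf{v}'\in\ker_{\mathbb{Z}}(A)$, the equation $\mathbf{u}=\mathbf{v}+\mathbf{v}'$ is a conformal decomposition of $\mathbf{u}$ if for all $1\le i\le n$: $u_i\ge 0$ implies $0\le v_i,v_i'\le u_i$, and $u_i\le 0$ implies $u_i\le v_i,v_i'\le 0$. The Graver basis $\mathcal{G}(A)$ is the set of all nonzero vectors in $\ker_{\mathbb{Z}}(A)$ that have no conformal decomposition (so $\mathbf{v}\in\mathcal{G}(A)$ if and only if $-\mathbf{v}\in\mathcal{G}(A)$, and both are included); it is a finite set. $B\cdot\mathcal{G}(A)$ denotes the $p\times|\mathcal{G}(A)|$ matrix whose columns are the vectors $B\mathbf{v}$, one column for each $\mathbf{v}\in\mathcal{G}(A)$; $\mathcal{G}(B\cdot\mathcal{G}(A))$ is the Graver basis of this matrix. For an integer $r\ge1$ and matrices $A$ ($d\times n$, columns $a_1,\ldots,a_n$) and $B$ ($p\times n$, columns $b_1,\ldots,b_n$), the $r$-th generalized Lawrence lifting of $A$ with $B$ is the $(rd+p)\times rn$ matrix $\Lambda(A,B,r)$ whose columns are the vectors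 $(a_i\otimes e_j)\oplus b_i$, $1\le i\le n$, $1\le j\le r$, where $e_j$ is the $j$-th standard basis vector of $\mathbb{Z}^r$. Equivalently, writing vectors of $\mathbb{Z}^{rn}$ as $r\times n$ integer matrices with rows $u^1,\ldots,u^r$, such a matrix lies in $\ker_{\mathbb{Z}}(\Lambda(A,B,r))$ iff $Au^j=0$ for each $j$ and $B(u^1+\cdots+u^r)=0$. The type of a vector in $\mathbb{Z}^{rn}$, represented as an $r\times n$ matrix, is its number of nonzero rows. The Graver complexity $g(A,B)$ is the largest type of any element of $\mathcal{G}(\Lambda(A,B,r))$ as $r$ ranges over all positive integers. The maximum over an empty set is taken to be $0$. *)

theory Defs
  imports "Jordan_Normal_Form.Matrix_Kernel"
begin

text \<open>For an integer matrix, \<^const>\<open>mat_kernel\<close> is the integer kernel: the integer vectors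
  \<open>u\<close> of length \<open>dim_col M\<close> with \<open>M u = 0\<close>.\<close>

definition conformal_decomposition :: "int mat \<Rightarrow> int vec \<Rightarrow> int vec \<Rightarrow> int vec \<Rightarrow> bool" where
  "conformal_decomposition M u v v' \<longleftrightarrow>
     u \<in> mat_kernel M \<and> v \<in> mat_kernel M \<and> v' \<in> mat_kernel M \<and>
     u \<noteq> 0\<^sub>v (dim_col M) \<and> v \<noteq> 0\<^sub>v (dim_col M) \<and> v' \<noteq> 0\<^sub>v (dim_col M) \<and>
     u = v + v' \<and>
     (\<forall>i < dim_col M.
        (u $ i \<ge> 0 \<longrightarrow> 0 \<le> v $ i \<and> v $ i \<le> u $ i \<and> 0 \<le> v' $ i \<and> v' $ i \<le> u $ i) \<and>
        (u $ i \<le> 0 \<longrightarrow> u $ i \<le> v $ i \<and> v $ i \<le> 0 \<and> u $ i \<le> v' $ i \<and> v' $ i \<le> 0))"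

definition graver_basis :: "int mat \<Rightarrow> int vec set" where
  "graver_basis M =
     {u \<in> mat_kernel M. u \<noteq> 0\<^sub>v (dim_col M) \<and> (\<nexists>v v'. conformal_decomposition M u v v')}"

definition one_norm :: "int vec \<Rightarrow> nat" where
  "one_norm v = (\<Sum>i < dim_vec v. nat \<bar>v $ i\<bar>)"

definition tensor_vec :: "int vec \<Rightarrow> int vec \<Rightarrow> int vec" where
  "tensor_vec a e =
     vec (dim_vec a * dim_vec e) (\<lambda>k. a $ (k div dim_vec e) * e $ (k mod dim_vec e))"

text \<open>The column \<open>(a\<^sub>i \<otimes> e\<^sub>j) \<oplus> b\<^sub>i\<close> of the lifting stands at position \<open>j * n + i\<close>
  (indices start at 0), so a vector of length \<open>r * n\<close> lists the rows of the corresponding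
  \<open>r \<times> n\<close> matrix one after the other.\<close>

definition lawrence_lifting :: "int mat \<Rightarrow> int mat \<Rightarrow> nat \<Rightarrow> int mat" where
  "lawrence_lifting A B r =
     mat_of_cols (r * dim_row A + dim_row B)
       [tensor_vec (col A i) (unit_vec r j) @\<^sub>v col B i. j \<leftarrow> [0..<r], i \<leftarrow> [0..<dim_col A]]"

definition block_row :: "nat \<Rightarrow> int vec \<Rightarrow> nat \<Rightarrow> int vec" where
  "block_row n u j = vec n (\<lambda>i. u $ (j * n + i))"

definition vec_type :: "nat \<Rightarrow> nat \<Rightarrow> int vec \<Rightarrow> nat" where
  "vec_type r n u = card {j. j < r \<and> block_row n u j \<noteq> 0\<^sub>v n}"

definition graver_types :: "int mat \<Rightarrow> int mat \<Rightarrow> nat set" where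
  "graver_types A B =
     {vec_type r (dim_col A) u | r u. r \<ge> 1 \<and> u \<in> graver_basis (lawrence_lifting A B r)}"

text \<open>On \<^typ>\<open>nat\<close>, the supremum of a finite set is its maximum, and 0 if the set is empty.\<close>

definition graver_complexity :: "int mat \<Rightarrow> int mat \<Rightarrow> nat" where
  "graver_complexity A B = Sup (graver_types A B)"

text \<open>\<open>B \<cdot> G\<close> for a list \<open>vs\<close> enumerating the finite set of vectors \<open>G\<close>.\<close>

definition mult_cols :: "int mat \<Rightarrow> int vec list \<Rightarrow> int mat" where
  "mult_cols B vs = mat_of_cols (dim_row B) (map (\<lambda>v. B *\<^sub>v v) vs)"

lemma incseq_nat_subseq:
  fixes s :: "nat \<Rightarrow> nat"
  shows "\<exists>r :: nat \<Rightarrow> nat. strict_mono r \<and> mono (s \<circ> r)"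
proof -
  obtain g :: "nat \<Rightarrow> nat" where g: "strict_mono g" "monoseq (\<lambda>n. s (g n))"
    using seq_monosub by blast
  show ?thesis
  proof (cases "mono (\<lambda>n. s (g n))")
    case True
    then show ?thesis using g(1) by (auto simp: comp_def)
  next
    case False
    then have dec: "\<And>m n. m \<le> n \<Longrightarrow> s (g n) \<le> s (g m)"
      using g(2) by (auto simp: monoseq_iff decseq_def)
    define k where "k = (ARG_MIN (\<lambda>n. s (g n)) n. True)"
    have "s (g k) \<le> s (g n)" for n
      unfolding k_def by (rule arg_min_nat_le) simp
    then have "s (g (k + n)) = s (g k)" for n
      using dec[of k "k + n"] by (simp add: le_antisym)
    then have "mono (s \<circ> (\<lambda>n. g (k + n)))"
      by (simp add: mono_def)
    moreover have "strict_mono (\<lambda>n. g (k + n))"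
      using g(1) by (simp add: strict_mono_def)
    ultimately show ?thesis by blast
  qed
qed

lemma dickson_subseq:
  fixes f :: "nat \<Rightarrow> 'i \<Rightarrow> nat"
  assumes "finite I"
  shows "\<exists>r :: nat \<Rightarrow> nat. strict_mono r \<and> (\<forall>i\<in>I. mono (\<lambda>k. f (r k) i))"
  using assms
proof (induction I)
  case empty
  show ?case by (auto intro: exI[of _ id] simp: strict_mono_def)
next
  case (insert x I)
  then obtain r :: "nat \<Rightarrow> nat" where r: "strict_mono r" "\<forall>i\<in>I. mono (\<lambda>k. f (r k) i)" by blast
  obtain t :: "nat \<Rightarrow> nat" where t: "strict_mono t" "mono ((\<lambda>k. f (r k) x) \<circ> t)"
    using incseq_nat_subseq by blast
  have "strict_mono (r \<circ> t)" using r(1) t(1) by (rule strict_mono_o)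
  moreover have "\<forall>i\<in>insert x I. mono (\<lambda>k. f ((r \<circ> t) k) i)"
    using r(2) t strict_mono_mono[OF t(1)] by (auto simp: mono_def comp_def)
  ultimately show ?case by blast
qed

theorem finite_graver_basis: "finite (graver_basis M)"
proof (rule ccontr)
  assume "infinite (graver_basis M)"
  then obtain f :: "nat \<Rightarrow> int vec" where f: "inj f" "range f \<subseteq> graver_basis M"
    using infinite_countable_subset by blast
  let ?n = "dim_col M"
  let ?h = "\<lambda>k (i, b). nat (if b then f k $ i else - f k $ i)"
  obtain r :: "nat \<Rightarrow> nat" where r: "strict_mono r" "\<forall>c\<in>{..<?n} \<times> UNIV. mono (\<lambda>k. ?h (r k) c)"
    using dickson_subseq[of "{..<?n} \<times> (UNIV :: bool set)" ?h] by auto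
  define u where "u = f (r 0)"
  define w where "w = f (r 1)"
  have "r 0 \<noteq> r 1" using strict_monoD[OF r(1), of 0 1] by simp
  then have ne: "u \<noteq> w" using f(1) unfolding u_def w_def by (simp add: inj_eq)
  have G: "u \<in> graver_basis M" "w \<in> graver_basis M" using f(2) by (auto simp: u_def w_def)
  then have K: "u \<in> mat_kernel M" "w \<in> mat_kernel M"
    and nz: "u \<noteq> 0\<^sub>v ?n" "w \<noteq> 0\<^sub>v ?n" by (auto simp: graver_basis_def)
  have M: "M \<in> carrier_mat (dim_row M) ?n" by simp
  have c: "u \<in> carrier_vec ?n" "w \<in> carrier_vec ?n" using K by (auto simp: mat_kernel_def)
  have le: "nat (u $ i) \<le> nat (w $ i)" "nat (- u $ i) \<le> nat (- w $ i)" if "i < ?n" for i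
    using r(2)[rule_format, of "(i, True)", THEN monoD, of 0 1]
      r(2)[rule_format, of "(i, False)", THEN monoD, of 0 1] that
    by (auto simp: u_def w_def)
  have Kd: "w - u \<in> mat_kernel M"
    using K c mult_minus_distrib_mat_vec[OF M c(2) c(1)] by (auto simp: mat_kernel_def)
  have nzd: "w - u \<noteq> 0\<^sub>v ?n"
  proof
    assume *: "w - u = 0\<^sub>v ?n"
    have "w $ i = u $ i" if "i < ?n" for i
      using arg_cong[OF *, of "\<lambda>v. v $ i"] that c by simp
    then show False using ne c by auto
  qed
  have "w = u + (w - u)" using c by auto
  then have "conformal_decomposition M w u (w - u)"
    unfolding conformal_decomposition_def using K Kd nz nzd c le by fastforce
  then show False using G(2) by (auto simp: graver_basis_def)
qed

end

theory Submission
  imports Defs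
begin

text \<open>Every row of a Graver element of the lifting is a conformal sum of elements of the Graver basis
  of \<open>A\<close>. The vector \<open>\<lambda>\<close> counting how often each Graver element occurs in these sums lies in the
  kernel of \<open>B \<cdot> G(A)\<close>, and its 1-norm is at least the number of nonzero rows. A conformal part of \<open>\<lambda>\<close>
  selects some of the summands and hence a conformal part of the given element, so \<open>\<lambda>\<close> is a
  Graver element.
  Conversely, a Graver element \<open>\<lambda>\<close> of \<open>B \<cdot> G(A)\<close> yields the matrix in which the row \<open>sgn \<lambda>\<^sub>v \<cdot> v\<close> is
  repeated \<open>\<bar>\<lambda>\<^sub>v\<bar>\<close> times. Its rows are themselves Graver elements, so a conformal part consists
  of some of the rows and corresponds to a conformal part of \<open>\<lambda>\<close>.\<close>

section \<open>Conformal order, kernels and Graver elements\<close>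

text \<open>The box between \<open>0\<close> and \<open>u\<close>: \<open>min\<close> and
  \<open>max\<close> merge the two sign cases of a conformal decomposition. Only one summand is
  recorded, since \<open>u - v\<close> then lies in the same box.\<close>

definition conformal_le :: "int vec \<Rightarrow> int vec \<Rightarrow> bool" where
  "conformal_le v u \<longleftrightarrow> dim_vec v = dim_vec u \<and>
     (\<forall>i < dim_vec u. min 0 (u $ i) \<le> v $ i \<and> v $ i \<le> max 0 (u $ i))"

lemma conformal_le_trans:
  assumes "conformal_le u v" and "conformal_le v w"
  shows "conformal_le u w"
  using assms unfolding conformal_le_def by fastforce

lemma conformal_le_diff:
  assumes "conformal_le v u"
  shows "conformal_le (u - v) u"
  using assms unfolding conformal_le_def by fastforce

lemma mult_mat_vec_nth:
  assumes "v \<in> carrier_vec (dim_col M)" and "k < dim_row M"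
  shows "(M *\<^sub>v v) $ k = (\<Sum>i<dim_col M. M $$ (k, i) * v $ i)"
  using assms by (auto simp: scalar_prod_def atLeast0LessThan intro!: sum.cong)

lemma mat_kernel_iff:
  "v \<in> mat_kernel M \<longleftrightarrow> v \<in> carrier_vec (dim_col M) \<and>
     (\<forall>k < dim_row M. (\<Sum>i<dim_col M. M $$ (k, i) * v $ i) = 0)"
proof (cases "v \<in> carrier_vec (dim_col M)")
  case True
  have "M *\<^sub>v v = 0\<^sub>v (dim_row M) \<longleftrightarrow> (\<forall>k < dim_row M. (M *\<^sub>v v) $ k = 0)"
    by (simp add: vec_eq_iff del: index_mult_mat_vec)
  then show ?thesis
    using True mult_mat_vec_nth[OF True] by (auto simp: mat_kernel_def)
qed (auto simp: mat_kernel_def)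

lemma mat_kernel_diff:
  assumes "u \<in> mat_kernel M" and "v \<in> mat_kernel M"
  shows "u - v \<in> mat_kernel M"
  using assms by (auto simp: mat_kernel_iff right_diff_distrib sum_subtractf)

text \<open>In a decomposition of \<open>u\<close> the summand \<open>v\<close> determines the other
  one, \<open>u - v\<close>, which is again in the kernel and in the box of \<open>u\<close>; both
  are nonzero exactly when \<open>v\<close> is neither \<open>0\<close> nor \<open>u\<close>. Graver
  elements are thus the minimal nonzero kernel elements for \<open>conformal_le\<close>.\<close>

lemma graver_basis_iff:
  "u \<in> graver_basis M \<longleftrightarrow> u \<in> mat_kernel M \<and> u \<noteq> 0\<^sub>v (dim_col M) \<and>
     (\<forall>v \<in> mat_kernel M. conformal_le v u \<longrightarrow> v = 0\<^sub>v (dim_col M) \<or> v = u)"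
proof (cases "u \<in> mat_kernel M \<and> u \<noteq> 0\<^sub>v (dim_col M)")
  case True
  let ?n = "dim_col M"
  have u: "u \<in> carrier_vec ?n" using True by (auto simp: mat_kernel_iff)
  have "(\<exists>v v'. conformal_decomposition M u v v') \<longleftrightarrow>
    (\<exists>v \<in> mat_kernel M. conformal_le v u \<and> v \<noteq> 0\<^sub>v ?n \<and> v \<noteq> u)" (is "?L \<longleftrightarrow> ?R")
  proof
    assume ?L
    then obtain v v' where c: "conformal_decomposition M u v v'" by blast
    then have K: "v \<in> mat_kernel M" "v' \<in> mat_kernel M" "v \<noteq> 0\<^sub>v ?n" "v' \<noteq> 0\<^sub>v ?n" "u = v + v'"
      by (auto simp: conformal_decomposition_def)
    then have d: "v \<in> carrier_vec ?n" "v' \<in> carrier_vec ?n" by (auto simp: mat_kernel_iff)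
    have "min 0 (u $ i) \<le> v $ i \<and> v $ i \<le> max 0 (u $ i)" if "i < ?n" for i
    proof -
      have "(0 \<le> u $ i \<longrightarrow> 0 \<le> v $ i \<and> v $ i \<le> u $ i) \<and>
          (u $ i \<le> 0 \<longrightarrow> u $ i \<le> v $ i \<and> v $ i \<le> 0)"
        using c that unfolding conformal_decomposition_def by blast
      then show ?thesis by linarith
    qed
    then have "conformal_le v u" using d u by (simp add: conformal_le_def)
    moreover have "v \<noteq> u"
    proof
      assume "v = u"
      then have "v $ i + v' $ i = v $ i" if "i < ?n" for i
        using K(5) d that by (metis carrier_vecD index_add_vec(1))
      then have "v' = 0\<^sub>v ?n" using d by (intro eq_vecI) auto
      then show False using K by simp
    qed
    ultimately show ?R using K by blast
  next
    assume ?R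
    then obtain v where v: "v \<in> mat_kernel M" "conformal_le v u" "v \<noteq> 0\<^sub>v ?n" "v \<noteq> u" by blast
    have d: "v \<in> carrier_vec ?n" using v by (auto simp: mat_kernel_iff)
    have "u - v \<noteq> 0\<^sub>v ?n"
    proof
      assume *: "u - v = 0\<^sub>v ?n"
      have "v $ i = u $ i" if "i < ?n" for i
        using arg_cong[OF *, of "\<lambda>v. v $ i"] that d u by simp
      then show False using v(4) d u by auto
    qed
    moreover have "u = v + (u - v)" using d u by auto
    moreover have "(0 \<le> u $ i \<longrightarrow> 0 \<le> v $ i \<and> v $ i \<le> u $ i \<and> 0 \<le> (u - v) $ i \<and> (u - v) $ i \<le> u $ i) \<and>
        (u $ i \<le> 0 \<longrightarrow> u $ i \<le> v $ i \<and> v $ i \<le> 0 \<and> u $ i \<le> (u - v) $ i \<and> (u - v) $ i \<le> 0)"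
      if "i < ?n" for i
    proof -
      have "min 0 (u $ i) \<le> v $ i" "v $ i \<le> max 0 (u $ i)" "(u - v) $ i = u $ i - v $ i"
        using v(2) that d u by (auto simp: conformal_le_def)
      then show ?thesis by linarith
    qed
    ultimately have "conformal_decomposition M u v (u - v)"
      using True v(1,3) mat_kernel_diff[of u M v] unfolding conformal_decomposition_def by blast
    then show ?L by blast
  qed
  then show ?thesis using True unfolding graver_basis_def by blast
qed (auto simp: graver_basis_def)

text \<open>Conformality rules out opposite signs, so no entry of \<open>v\<close> exceeds that of
  \<open>u\<close> in absolute value, and an entry that differs is strictly smaller. This makes the
  1-norm a termination measure for conformal splitting.\<close>

lemma one_norm_less:
  assumes "conformal_le v u" and "v \<noteq> u"
  shows "one_norm v < one_norm u"
proof -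
  have d: "dim_vec v = dim_vec u" using assms by (simp add: conformal_le_def)
  obtain i where i: "i < dim_vec u" "v $ i \<noteq> u $ i" using assms(2) d by (auto simp: vec_eq_iff)
  have le: "min 0 (u $ j) \<le> v $ j" "v $ j \<le> max 0 (u $ j)" if "j < dim_vec u" for j
    using assms(1) that by (auto simp: conformal_le_def)
  show ?thesis unfolding one_norm_def d
  proof (rule sum_strict_mono_ex1)
    show "\<forall>j\<in>{..<dim_vec u}. nat \<bar>v $ j\<bar> \<le> nat \<bar>u $ j\<bar>"
    proof
      fix j
      assume "j \<in> {..<dim_vec u}"
      then show "nat \<bar>v $ j\<bar> \<le> nat \<bar>u $ j\<bar>"
        using le[of j] by (auto simp: min_def max_def split: if_splits)
    qed
    show "\<exists>j\<in>{..<dim_vec u}. nat \<bar>v $ j\<bar> < nat \<bar>u $ j\<bar>"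
      using le[OF i(1)] i by (intro bexI[of _ i]) (auto simp: min_def max_def split: if_splits)
  qed simp
qed

text \<open>Induction on the 1-norm: a kernel vector that is neither zero nor a Graver element
  splits into \<open>v\<close> and \<open>u - v\<close>, both conformal to it and of smaller norm. A
  list records the summands because a Graver element may be repeated.\<close>

lemma graver_conformal_sum:
  assumes "u \<in> mat_kernel M"
  shows "\<exists>ws. set ws \<subseteq> graver_basis M \<and> (\<forall>w \<in> set ws. conformal_le w u) \<and>
    (\<forall>i < dim_col M. u $ i = (\<Sum>w\<leftarrow>ws. w $ i))"
  using assms
proof (induction "one_norm u" arbitrary: u rule: less_induct)
  case less
  let ?n = "dim_col M"
  have u: "dim_vec u = ?n" using less.prems by (auto simp: mat_kernel_iff)
  consider "u = 0\<^sub>v ?n" | "u \<in> graver_basis M"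
    | v where "v \<in> mat_kernel M" "conformal_le v u" "v \<noteq> 0\<^sub>v ?n" "v \<noteq> u"
    using less.prems graver_basis_iff[of u M] by blast
  then show ?case
  proof cases
    case 1
    then show ?thesis by (intro exI[of _ "[]"]) auto
  next
    case 2
    then show ?thesis by (intro exI[of _ "[u]"]) (auto simp: conformal_le_def)
  next
    case 3
    have dv: "dim_vec v = ?n" using 3 u by (auto simp: conformal_le_def)
    have "u - v \<noteq> u"
    proof
      assume *: "u - v = u"
      have "v $ i = 0" if "i < ?n" for i
        using arg_cong[OF *, of "\<lambda>v. v $ i"] that dv u by simp
      then show False using 3(3) dv by (auto simp: vec_eq_iff)
    qed
    then have "one_norm v < one_norm u" "one_norm (u - v) < one_norm u"
      using 3 one_norm_less conformal_le_diff by blast+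
    from less.hyps[OF this(1) 3(1)] less.hyps[OF this(2) mat_kernel_diff[OF less.prems 3(1)]]
    obtain vs ws where
      v: "set vs \<subseteq> graver_basis M" "\<forall>w \<in> set vs. conformal_le w v"
         "\<forall>i < ?n. v $ i = (\<Sum>w\<leftarrow>vs. w $ i)" and
      w: "set ws \<subseteq> graver_basis M" "\<forall>w \<in> set ws. conformal_le w (u - v)"
         "\<forall>i < ?n. (u - v) $ i = (\<Sum>w\<leftarrow>ws. w $ i)"
      by blast
    have "u $ i = (\<Sum>w\<leftarrow>vs @ ws. w $ i)" if "i < ?n" for i
      using v(3)[rule_format, OF that] w(3)[rule_format, OF that] that dv u by simp
    moreover have "\<forall>w \<in> set (vs @ ws). conformal_le w u"
      using v(2) w(2) 3(2) conformal_le_diff[OF 3(2)] conformal_le_trans by (metis Un_iff set_append)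
    moreover have "set (vs @ ws) \<subseteq> graver_basis M" using v(1) w(1) by simp
    ultimately show ?thesis by blast
  qed
qed

section \<open>Coordinates and kernel of the Lawrence lifting\<close>

lemma length_concat_map_upt: "length (concat (map (\<lambda>j. map (f j) [0..<n]) [0..<r])) = r * n"
  by (induction r) auto

lemma block_index_less:
  fixes j i r n :: nat
  assumes "j < r" and "i < n"
  shows "j * n + i < r * n"
proof -
  have "j * n + i < Suc j * n" using assms(2) by simp
  also have "\<dots> \<le> r * n" using assms(1) by (intro mult_le_mono1) simp
  finally show ?thesis .
qed

lemma nth_concat_map_upt:
  assumes "j < r" and "i < n"
  shows "concat (map (\<lambda>j. map (f j) [0..<n]) [0..<r]) ! (j * n + i) = f j i"
  using assms(1)
proof (induction r)
  case (Suc r)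
  have "j * n + i < r * n" if "j < r" using that assms(2) by (rule block_index_less)
  then show ?case using Suc assms(2)
    by (cases "j = r") (auto simp: nth_append length_concat_map_upt)
qed simp

text \<open>Row and column are recovered from a flat position by \<open>div\<close> and
  \<open>mod\<close>, so a condition on a flat vector becomes one on the rows of its matrix.\<close>

lemma all_block_index:
  fixes r n :: nat
  shows "(\<forall>m < r * n. P m) \<longleftrightarrow> (\<forall>j < r. \<forall>i < n. P (j * n + i))"
proof (intro iffI allI impI)
  fix m assume a: "\<forall>j < r. \<forall>i < n. P (j * n + i)" "m < r * n"
  have "m mod n < n" using a(2) by (cases "n = 0") auto
  moreover have "m div n < r" using a(2) by (rule less_mult_imp_div_less)
  ultimately have "P ((m div n) * n + m mod n)" using a(1) by blast
  then show "P m" by simp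
qed (simp add: block_index_less)

lemma sum_block_index:
  fixes f :: "nat \<Rightarrow> 'a :: comm_monoid_add"
  shows "(\<Sum>m<r * n. f m) = (\<Sum>j<r. \<Sum>i<n. f (j * n + i))"
proof -
  have "(\<Sum>i<n. f (j * n + i)) = sum f {j * n..<j * n + n}" for j
    by (rule sum.reindex_bij_witness[of _ "\<lambda>m. m - j * n" "\<lambda>i. j * n + i"]) auto
  then show ?thesis by (simp add: sum.nat_group)
qed

lemma dim_lawrence_lifting [simp]:
  "dim_row (lawrence_lifting A B r) = r * dim_row A + dim_row B"
  "dim_col (lawrence_lifting A B r) = r * dim_col A"
  using length_concat_map_upt by (auto simp: lawrence_lifting_def)

text \<open>The two index orders differ: in \<open>tensor_vec\<close> the entry of the unit vector
  runs fastest, so the upper rows are \<open>s * r + t\<close>, whereas the columns list the copies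
  \<open>j\<close> one after the other. The rows of \<open>B\<close> start after the
  \<open>r * dim_row A\<close> upper rows.\<close>

lemma lawrence_lifting_index:
  assumes "j < r" and "i < dim_col A" and "dim_col B = dim_col A"
  shows "s < dim_row A \<Longrightarrow> t < r \<Longrightarrow>
      lawrence_lifting A B r $$ (s * r + t, j * dim_col A + i) = (if t = j then A $$ (s, i) else 0)"
    and "k < dim_row B \<Longrightarrow>
      lawrence_lifting A B r $$ (r * dim_row A + k, j * dim_col A + i) = B $$ (k, i)"
proof -
  let ?n = "dim_col A"
  have c: "lawrence_lifting A B r $$ (q, j * ?n + i) =
      (tensor_vec (col A i) (unit_vec r j) @\<^sub>v col B i) $ q" if "q < r * dim_row A + dim_row B" for q
    using that assms block_index_less[OF assms(1,2)] unfolding lawrence_lifting_def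
    by (subst mat_of_cols_index) (simp_all add: nth_concat_map_upt length_concat_map_upt)
  show "lawrence_lifting A B r $$ (s * r + t, j * ?n + i) = (if t = j then A $$ (s, i) else 0)"
    if "s < dim_row A" "t < r"
    using block_index_less[OF that] that assms
    by (subst c) (auto simp: tensor_vec_def mult.commute)
  show "lawrence_lifting A B r $$ (r * dim_row A + k, j * ?n + i) = B $$ (k, i)"
    if "k < dim_row B"
    using that assms by (subst c) (auto simp: tensor_vec_def mult.commute)
qed

lemma dim_block_row [simp]: "dim_vec (block_row n u j) = n"
  by (simp add: block_row_def)

lemma block_row_carrier [simp]: "block_row n u j \<in> carrier_vec n"
  by (simp add: block_row_def)

lemma block_row_index [simp]: "i < n \<Longrightarrow> block_row n u j $ i = u $ (j * n + i)"
  by (simp add: block_row_def)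

lemma vec_eq_iff_block_row:
  assumes "dim_vec u = r * n" and "dim_vec v = r * n"
  shows "u = v \<longleftrightarrow> (\<forall>j < r. block_row n u j = block_row n v j)"
  using assms all_block_index[of r n "\<lambda>m. u $ m = v $ m"] by (simp add: vec_eq_iff)

lemma conformal_le_iff_block_row:
  assumes "dim_vec u = r * n" and "dim_vec v = r * n"
  shows "conformal_le u v \<longleftrightarrow> (\<forall>j < r. conformal_le (block_row n u j) (block_row n v j))"
  using assms all_block_index[of r n "\<lambda>m. min 0 (v $ m) \<le> u $ m \<and> u $ m \<le> max 0 (v $ m)"]
  by (simp add: conformal_le_def)

lemma block_row_zero [simp]: "j < r \<Longrightarrow> block_row n (0\<^sub>v (r * n)) j = 0\<^sub>v n"
  by (auto simp: vec_eq_iff block_index_less)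

text \<open>An upper row \<open>s * r + t\<close> sees only block \<open>t\<close> of
  \<open>u\<close>, where it acts as row \<open>s\<close> of \<open>A\<close>; a lower row applies
  the same row of \<open>B\<close> to every block and adds the results.\<close>

lemma mat_kernel_lawrence_lifting_iff:
  assumes "dim_col A = n" and "dim_col B = n"
  shows "u \<in> mat_kernel (lawrence_lifting A B r) \<longleftrightarrow> u \<in> carrier_vec (r * n) \<and>
    (\<forall>j < r. block_row n u j \<in> mat_kernel A) \<and>
    (\<forall>k < dim_row B. (\<Sum>j<r. \<Sum>i<n. B $$ (k, i) * block_row n u j $ i) = 0)"
proof -
  let ?L = "lawrence_lifting A B r"
  let ?P = "\<lambda>q. (\<Sum>m<r * n. ?L $$ (q, m) * u $ m) = 0"
  have up: "(\<Sum>m<r * n. ?L $$ (s * r + t, m) * u $ m) = (\<Sum>i<n. A $$ (s, i) * block_row n u t $ i)"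
    if "s < dim_row A" "t < r" for s t
  proof -
    have "(\<Sum>m<r * n. ?L $$ (s * r + t, m) * u $ m) =
        (\<Sum>j<r. \<Sum>i<n. (if t = j then A $$ (s, i) else 0) * u $ (j * n + i))"
      using that assms by (simp add: sum_block_index lawrence_lifting_index(1)[where A = A, unfolded assms(1)])
    also have "\<dots> = (\<Sum>j<r. if t = j then \<Sum>i<n. A $$ (s, i) * u $ (j * n + i) else 0)"
      by (rule sum.cong) auto
    finally show ?thesis using that by simp
  qed
  have low: "(\<Sum>m<r * n. ?L $$ (r * dim_row A + k, m) * u $ m) =
      (\<Sum>j<r. \<Sum>i<n. B $$ (k, i) * block_row n u j $ i)"
    if "k < dim_row B" for k
    using that assms by (simp add: sum_block_index lawrence_lifting_index(2)[where A = A, unfolded assms(1)])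
  \<comment> \<open>The bound is commuted to \<open>dim_row A * r\<close> so that
    \<open>all_block_index\<close> splits an upper row into block number \<open>s\<close> and offset
    \<open>t\<close>.\<close>
  have "(\<forall>q < r * dim_row A + dim_row B. ?P q) \<longleftrightarrow>
      (\<forall>q < dim_row A * r. ?P q) \<and> (\<forall>k < dim_row B. ?P (r * dim_row A + k))"
    by (auto simp: mult.commute) (metis add_diff_inverse_nat nat_add_left_cancel_less)
  also have "(\<forall>q < dim_row A * r. ?P q) \<longleftrightarrow>
      (\<forall>s < dim_row A. \<forall>t < r. (\<Sum>i<n. A $$ (s, i) * block_row n u t $ i) = 0)"
    unfolding all_block_index using up by auto
  finally show ?thesis
    using low assms unfolding mat_kernel_iff dim_lawrence_lifting by auto
qed

section \<open>The matrix of images of Graver elements, multiplicities, and sums without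
  cancellation\<close>

lemma dim_mult_cols [simp]:
  "dim_row (mult_cols B vs) = dim_row B" "dim_col (mult_cols B vs) = length vs"
  by (auto simp: mult_cols_def)

lemma mult_cols_index:
  assumes "set vs \<subseteq> carrier_vec (dim_col B)" and "k < dim_row B" and "a < length vs"
  shows "mult_cols B vs $$ (k, a) = (\<Sum>i<dim_col B. B $$ (k, i) * vs ! a $ i)"
proof -
  have "vs ! a \<in> carrier_vec (dim_col B)" using assms by auto
  then have "(B *\<^sub>v vs ! a) $ k = (\<Sum>i<dim_col B. B $$ (k, i) * vs ! a $ i)"
    using mult_mat_vec_nth assms by blast
  then show ?thesis using assms by (simp add: mult_cols_def mat_of_cols_index)
qed

text \<open>\<open>S\<close> splits into the fibers of \<open>c\<close>, on each of which
  \<open>g (c x)\<close> is constant. This trades a count with multiplicities for a sum over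
  labelled items.\<close>

lemma sum_card_fibers:
  fixes c :: "'a \<Rightarrow> nat" and g :: "nat \<Rightarrow> int"
  assumes "finite S" and "c ` S \<subseteq> {..<N}"
  shows "(\<Sum>a<N. g a * int (card {x \<in> S. c x = a})) = (\<Sum>x\<in>S. g (c x))"
proof -
  have "(\<Sum>x\<in>S. g (c x)) = (\<Sum>a<N. \<Sum>x\<in>{x \<in> S. c x = a}. g (c x))"
    using sum.group[OF assms(1) _ assms(2), of "\<lambda>x. g (c x)"] by simp
  also have "\<dots> = (\<Sum>a<N. g a * int (card {x \<in> S. c x = a}))"
    by (rule sum.cong) (auto simp: mult.commute)
  finally show ?thesis by simp
qed

text \<open>Read \<open>c x\<close> as the position in \<open>vs\<close> of the vector carried by
  the item \<open>x\<close>, and \<open>t\<close> as a sign attached to that position: the matrix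
  sends the signed multiplicity vector to the sum of the images under \<open>B\<close> of all signed
  items. One inequality uses it with \<open>t\<close> constantly 1, the other with the signs of a
  Graver element.\<close>

lemma mult_cols_fibers:
  fixes c :: "'a \<Rightarrow> nat" and t :: "nat \<Rightarrow> int"
  assumes "set vs \<subseteq> carrier_vec n" and "dim_col B = n" and "k < dim_row B"
    and "finite S" and "c ` S \<subseteq> {..<length vs}"
  shows "(\<Sum>a<length vs. mult_cols B vs $$ (k, a) * (t a * int (card {x \<in> S. c x = a}))) =
    (\<Sum>x\<in>S. \<Sum>i<n. B $$ (k, i) * (t (c x) * vs ! c x $ i))"
proof -
  have "(\<Sum>a<length vs. mult_cols B vs $$ (k, a) * (t a * int (card {x \<in> S. c x = a}))) =
      (\<Sum>x\<in>S. mult_cols B vs $$ (k, c x) * t (c x))"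
    using sum_card_fibers[OF assms(4,5), of "\<lambda>a. mult_cols B vs $$ (k, a) * t a"]
    by (simp add: mult.assoc)
  also have "\<dots> = (\<Sum>x\<in>S. \<Sum>i<n. B $$ (k, i) * (t (c x) * vs ! c x $ i))"
  proof (rule sum.cong)
    fix x assume "x \<in> S"
    then have "c x < length vs" using assms(5) by auto
    then show "mult_cols B vs $$ (k, c x) * t (c x) = (\<Sum>i<n. B $$ (k, i) * (t (c x) * vs ! c x $ i))"
      using assms(1-3) by (simp add: mult_cols_index sum_distrib_left ac_simps)
  qed simp
  finally show ?thesis .
qed

text \<open>Terms between \<open>0\<close> and the total share the sign of the total, so nothing
  cancels: partial sums stay in the same box and vanish only if each of their terms does.\<close>

lemma conformal_subsum:
  fixes f :: "'a \<Rightarrow> int"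
  assumes "finite I" and "S \<subseteq> I"
    and "\<And>x. x \<in> I \<Longrightarrow> min 0 (sum f I) \<le> f x \<and> f x \<le> max 0 (sum f I)"
  shows "min 0 (sum f I) \<le> sum f S" and "sum f S \<le> max 0 (sum f I)"
    and "sum f S = 0 \<Longrightarrow> x \<in> S \<Longrightarrow> f x = 0"
proof -
  \<comment> \<open>The nonnegative case; below, \<open>g\<close> is \<open>f\<close> or its
    negative, according to the sign of the total.\<close>
  have nonneg: "0 \<le> sum g S \<and> sum g S \<le> sum g I \<and> (sum g S = 0 \<longrightarrow> (\<forall>x\<in>S. g x = 0))"
    if "\<And>x. x \<in> I \<Longrightarrow> 0 \<le> g x" for g :: "'a \<Rightarrow> int"
  proof (intro conjI)
    have pos: "\<And>x. x \<in> S \<Longrightarrow> 0 \<le> g x" using that assms(2) by blast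
    then show "0 \<le> sum g S" by (rule sum_nonneg)
    show "sum g S \<le> sum g I" using that by (intro sum_mono2 assms(1,2)) blast
    show "sum g S = 0 \<longrightarrow> (\<forall>x\<in>S. g x = 0)"
      using sum_nonneg_eq_0_iff[OF finite_subset[OF assms(2,1)], of g] pos by simp
  qed
  have *: "min 0 (sum f I) \<le> sum f S \<and> sum f S \<le> max 0 (sum f I) \<and>
      (sum f S = 0 \<longrightarrow> (\<forall>x\<in>S. f x = 0))"
  proof (cases "0 \<le> sum f I")
    case True
    have "0 \<le> f x" if "x \<in> I" for x using assms(3)[OF that] True by linarith
    from nonneg[of f, OF this] show ?thesis using True by linarith
  next
    case False
    have "0 \<le> - f x" if "x \<in> I" for x using assms(3)[OF that] False by linarith
    from nonneg[of "\<lambda>x. - f x", OF this]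
    have "sum f S \<le> 0 \<and> sum f I \<le> sum f S \<and> (sum f S = 0 \<longrightarrow> (\<forall>x\<in>S. f x = 0))"
      unfolding sum_negf neg_equal_0_iff_equal neg_0_le_iff_le neg_le_iff_le .
    then show ?thesis using False by linarith
  qed
  show "min 0 (sum f I) \<le> sum f S" "sum f S \<le> max 0 (sum f I)" using * by blast+
  show "f x = 0" if "sum f S = 0" "x \<in> S" using * that by blast
qed

text \<open>Flattens the matrix with rows \<open>F j\<close> in the layout that
  \<open>block_row\<close> reads back.\<close>

definition stack_rows :: "nat \<Rightarrow> nat \<Rightarrow> (nat \<Rightarrow> nat \<Rightarrow> int) \<Rightarrow> int vec" where
  "stack_rows r n F = vec (r * n) (\<lambda>m. F (m div n) (m mod n))"

lemma dim_stack_rows [simp]: "dim_vec (stack_rows r n F) = r * n"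
  by (simp add: stack_rows_def)

lemma block_row_stack_rows [simp]: "j < r \<Longrightarrow> block_row n (stack_rows r n F) j = vec n (F j)"
  by (auto simp: vec_eq_iff stack_rows_def block_index_less)

section \<open>Types are bounded by norms\<close>

lemma graver_type_le_one_norm:
  assumes n: "dim_col A = n" "dim_col B = n" and vs: "set vs = graver_basis A"
    and u: "u \<in> graver_basis (lawrence_lifting A B r)"
  shows "\<exists>l \<in> graver_basis (mult_cols B vs). vec_type r n u \<le> one_norm l"
proof -
  let ?N = "length vs" and ?M = "mult_cols B vs"
  have uK: "u \<in> mat_kernel (lawrence_lifting A B r)" and u0: "u \<noteq> 0\<^sub>v (r * n)"
    and umin: "\<And>v. v \<in> mat_kernel (lawrence_lifting A B r) \<Longrightarrow> conformal_le v u \<Longrightarrow>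
      v = 0\<^sub>v (r * n) \<or> v = u"
    using u n by (auto simp: graver_basis_iff)
  have ud: "dim_vec u = r * n" and uA: "\<And>j. j < r \<Longrightarrow> block_row n u j \<in> mat_kernel A"
    and uB: "\<And>k. k < dim_row B \<Longrightarrow> (\<Sum>j<r. \<Sum>i<n. B $$ (k, i) * block_row n u j $ i) = 0"
    using uK n by (auto simp: mat_kernel_lawrence_lifting_iff)
  have vsc: "set vs \<subseteq> carrier_vec n" using vs n by (auto simp: graver_basis_iff mat_kernel_iff)
  have "\<forall>j. \<exists>ws. j < r \<longrightarrow> set ws \<subseteq> graver_basis A \<and>
      (\<forall>w \<in> set ws. conformal_le w (block_row n u j)) \<and>
      (\<forall>i < n. block_row n u j $ i = (\<Sum>w\<leftarrow>ws. w $ i))"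
    using graver_conformal_sum[OF uA] n(1) by blast
  then obtain L where L: "\<And>j. j < r \<Longrightarrow> set (L j) \<subseteq> graver_basis A"
      "\<And>j w. j < r \<Longrightarrow> w \<in> set (L j) \<Longrightarrow> conformal_le w (block_row n u j)"
      "\<And>j i. j < r \<Longrightarrow> i < n \<Longrightarrow> block_row n u j $ i = (\<Sum>w\<leftarrow>L j. w $ i)"
    by metis
  \<comment> \<open>Summands are labelled by row and position in the list, so repetitions stay
    distinct and choosing some of the summands is choosing a subset of \<open>I\<close>.\<close>
  define I where "I = (SIGMA j:{..<r}. {..<length (L j)})"
  have finI: "finite I" by (simp add: I_def)
  have "\<forall>x\<in>I. \<exists>a<?N. vs ! a = L (fst x) ! snd x"
    using L(1) vs unfolding I_def by (auto simp: in_set_conv_nth[symmetric] dest!: nth_mem)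
  then obtain c where c: "\<And>x. x \<in> I \<Longrightarrow> c x < ?N" "\<And>x. x \<in> I \<Longrightarrow> vs ! c x = L (fst x) ! snd x"
    by metis
  \<comment> \<open>For a selection \<open>S\<close>, \<open>W S\<close> is the matrix of row sums
    of the selected summands, and \<open>lam S\<close> counts how many of them are assigned to each
    position of \<open>vs\<close>; \<open>W I\<close> recovers the rows of \<open>u\<close>.\<close>
  define W where "W S j i = (\<Sum>x | x \<in> S \<and> fst x = j. vs ! c x $ i)" for S j i
  define lam where "lam S = vec ?N (\<lambda>a. int (card {x \<in> S. c x = a}))" for S
  have fI: "fst x < r" if "x \<in> I" for x using that by (auto simp: I_def)
  have cS: "c ` S \<subseteq> {..<?N}" if "S \<subseteq> I" for S using that c(1) by blast
  have cG: "vs ! c x \<in> graver_basis A" if "x \<in> I" for x using c(1)[OF that] vs nth_mem by blast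
  have WI: "W I j i = block_row n u j $ i" if "j < r" "i < n" for j i
  proof -
    have "{x. x \<in> I \<and> fst x = j} = Pair j ` {..<length (L j)}" using that by (auto simp: I_def)
    then have "W I j i = (\<Sum>k<length (L j). vs ! c (j, k) $ i)"
      by (simp add: W_def sum.reindex inj_on_def)
    also have "\<dots> = (\<Sum>k<length (L j). L j ! k $ i)"
      using that by (intro sum.cong) (auto simp: c I_def)
    finally show ?thesis using L(3)[OF that] by (simp add: sum_list_sum_nth atLeast0LessThan)
  qed
  have wconf: "min 0 (W I j i) \<le> vs ! c x $ i \<and> vs ! c x $ i \<le> max 0 (W I j i)"
    if "x \<in> {x. x \<in> I \<and> fst x = j}" "i < n" for x j i
  proof -
    have x: "x \<in> I" "fst x = j" "j < r" using that fI[of x] by blast+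
    then have "vs ! c x \<in> set (L j)" using c(2)[OF x(1)] by (auto simp: I_def)
    then have "conformal_le (vs ! c x) (block_row n u j)" using L(2) x(3) by blast
    then show ?thesis using that(2) WI[OF x(3) that(2)] unfolding conformal_le_def by simp
  qed
  have Wconf: "min 0 (W I j i) \<le> W S j i \<and> W S j i \<le> max 0 (W I j i)"
    if "S \<subseteq> I" "i < n" for S j i
    using conformal_subsum(1,2)[of "{x. x \<in> I \<and> fst x = j}" "{x. x \<in> S \<and> fst x = j}" "\<lambda>x. vs ! c x $ i"]
      wconf[of _ j i] that finI unfolding W_def by auto
  \<comment> \<open>In each coordinate the summands of a row share a sign, so vanishing row sums
    make every selected summand zero, which no Graver element is.\<close>
  have Wzero: "S = {}" if S: "S \<subseteq> I" and z: "\<And>j i. j < r \<Longrightarrow> i < n \<Longrightarrow> W S j i = 0" for S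
  proof (rule ccontr)
    assume "S \<noteq> {}"
    then obtain x where x: "x \<in> S" by blast
    then have "vs ! c x \<in> graver_basis A" using cG S by blast
    then obtain i where i: "i < n" "vs ! c x $ i \<noteq> 0"
      using n by (auto simp: graver_basis_iff mat_kernel_iff vec_eq_iff)
    have "W S (fst x) i = 0" using z i fI x S by blast
    then have "vs ! c x $ i = 0"
      using conformal_subsum(3)[of "{y. y \<in> I \<and> fst y = fst x}" "{y. y \<in> S \<and> fst y = fst x}"
          "\<lambda>x. vs ! c x $ i" x] wconf[of _ "fst x" i] i(1) S x finI unfolding W_def by auto
    then show False using i by simp
  qed
  \<comment> \<open>Both sides add up \<open>B\<close> applied to the selected summands, grouped by
    position in \<open>vs\<close> on the left and by row on the right.\<close>
  have sumB: "(\<Sum>a<?N. ?M $$ (k, a) * lam S $ a) = (\<Sum>j<r. \<Sum>i<n. B $$ (k, i) * W S j i)"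
    if S: "S \<subseteq> I" and k: "k < dim_row B" for S k
  proof -
    have finS: "finite S" using finite_subset S finI .
    have "(\<Sum>a<?N. ?M $$ (k, a) * lam S $ a) = (\<Sum>x\<in>S. \<Sum>i<n. B $$ (k, i) * vs ! c x $ i)"
      using mult_cols_fibers[OF vsc n(2) k finS cS[OF S], of "\<lambda>_. 1"] by (simp add: lam_def)
    also have "\<dots> = (\<Sum>j<r. \<Sum>x | x \<in> S \<and> fst x = j. \<Sum>i<n. B $$ (k, i) * vs ! c x $ i)"
      using fI S by (intro sum.group[symmetric]) (auto simp: finS)
    also have "\<dots> = (\<Sum>j<r. \<Sum>i<n. B $$ (k, i) * W S j i)"
      unfolding W_def sum_distrib_left by (intro sum.cong refl sum.swap)
    finally show ?thesis .
  qed
  have ker: "stack_rows r n (W S) \<in> mat_kernel (lawrence_lifting A B r)"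
    if S: "S \<subseteq> I" and K: "lam S \<in> mat_kernel ?M" for S
  proof -
    have "vec n (W S j) \<in> mat_kernel A" if "j < r" for j
    proof -
      have "(\<Sum>i<n. A $$ (k, i) * W S j i) = 0" if k: "k < dim_row A" for k
      proof -
        have "(\<Sum>i<n. A $$ (k, i) * W S j i) =
            (\<Sum>x | x \<in> S \<and> fst x = j. \<Sum>i<n. A $$ (k, i) * vs ! c x $ i)"
          unfolding W_def sum_distrib_left by (rule sum.swap)
        also have "\<dots> = 0"
        proof (rule sum.neutral, rule ballI)
          fix x assume "x \<in> {x. x \<in> S \<and> fst x = j}"
          then have "vs ! c x \<in> graver_basis A" using cG S by blast
          then show "(\<Sum>i<n. A $$ (k, i) * vs ! c x $ i) = 0"
            using k n by (auto simp: graver_basis_iff mat_kernel_iff)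
        qed
        finally show ?thesis .
      qed
      then show ?thesis using n by (simp add: mat_kernel_iff)
    qed
    moreover have "(\<Sum>j<r. \<Sum>i<n. B $$ (k, i) * W S j i) = 0" if "k < dim_row B" for k
      using sumB[OF S that] K that by (simp add: mat_kernel_iff)
    ultimately show ?thesis
      using n by (auto simp: mat_kernel_lawrence_lifting_iff intro: carrier_vecI)
  qed
  have lamI: "lam I \<in> mat_kernel ?M"
    unfolding mat_kernel_iff dim_mult_cols
  proof (intro conjI allI impI)
    show "lam I \<in> carrier_vec ?N" by (simp add: lam_def)
    fix k assume k: "k < dim_row B"
    have "(\<Sum>j<r. \<Sum>i<n. B $$ (k, i) * W I j i) = (\<Sum>j<r. \<Sum>i<n. B $$ (k, i) * block_row n u j $ i)"
      by (intro sum.cong refl arg_cong2[where f = "(*)"] WI) simp_all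
    then show "(\<Sum>a<?N. ?M $$ (k, a) * lam I $ a) = 0"
      using sumB[OF order_refl k] uB[OF k] by (simp only:)
  qed
  have lam0: "lam S = 0\<^sub>v ?N \<longleftrightarrow> S = {}" if S: "S \<subseteq> I" for S
  proof
    assume z: "lam S = 0\<^sub>v ?N"
    show "S = {}"
    proof (rule ccontr)
      assume "S \<noteq> {}"
      then obtain x where x: "x \<in> S" by blast
      then have cx: "c x < ?N" using c(1) S by blast
      have "finite {y \<in> S. c y = c x}" using finite_subset[OF S finI] by simp
      then have "card {y \<in> S. c y = c x} \<noteq> 0" using x unfolding card_eq_0_iff by blast
      then have "lam S $ c x \<noteq> 0" using cx by (simp add: lam_def)
      then show False using z cx by simp
    qed
  qed (auto simp: lam_def)
  have "I \<noteq> {}"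
  proof
    assume "I = {}"
    then have "block_row n u j $ i = 0" if "j < r" "i < n" for i j
      using WI[OF that] by (simp add: W_def)
    then have "u = 0\<^sub>v (r * n)"
      using ud by (subst vec_eq_iff_block_row[where r = r and n = n]) (auto simp: vec_eq_iff block_index_less)
    then show False using u0 by simp
  qed
  have "lam I \<in> graver_basis ?M"
    unfolding graver_basis_iff dim_mult_cols
  proof (intro conjI ballI impI)
    show "lam I \<noteq> 0\<^sub>v ?N" using lam0 \<open>I \<noteq> {}\<close> by blast
    fix m assume m: "m \<in> mat_kernel ?M" "conformal_le m (lam I)"
    have dm: "dim_vec m = ?N" using m(1) by (auto simp: mat_kernel_iff)
    have mb: "0 \<le> m $ a \<and> m $ a \<le> int (card {x \<in> I. c x = a})" if "a < ?N" for a
    proof -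
      have "min 0 (lam I $ a) \<le> m $ a \<and> m $ a \<le> max 0 (lam I $ a)"
        using m(2) that by (simp add: conformal_le_def lam_def)
      then show ?thesis using that by (simp add: lam_def)
    qed
    \<comment> \<open>Since \<open>m $ a\<close> lies between 0 and the size of the fiber over
      \<open>a\<close>, that many summands can be picked from it. The union \<open>S\<close> of
      these choices realizes \<open>m\<close> as \<open>lam S\<close>.\<close>
    have "\<forall>a. \<exists>T. a < ?N \<longrightarrow> T \<subseteq> {x \<in> I. c x = a} \<and> int (card T) = m $ a"
    proof (intro allI)
      fix a
      show "\<exists>T. a < ?N \<longrightarrow> T \<subseteq> {x \<in> I. c x = a} \<and> int (card T) = m $ a"
      proof (cases "a < ?N")
        case True
        then have "nat (m $ a) \<le> card {x \<in> I. c x = a}" using mb by (simp add: nat_le_iff)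
        then obtain T where "T \<subseteq> {x \<in> I. c x = a}" "card T = nat (m $ a)"
          by (meson obtain_subset_with_card_n)
        then show ?thesis using mb[OF True] by (intro exI[of _ T]) simp
      qed simp
    qed
    then obtain T where T: "\<And>a. a < ?N \<Longrightarrow> T a \<subseteq> {x \<in> I. c x = a}"
        "\<And>a. a < ?N \<Longrightarrow> int (card (T a)) = m $ a"
      by metis
    define S where "S = (\<Union>a<?N. T a)"
    have S: "S \<subseteq> I" using T(1) by (auto simp: S_def)
    have "{x \<in> S. c x = a} = T a" if "a < ?N" for a using T(1) that by (fastforce simp: S_def)
    then have mS: "m = lam S" using T(2) dm by (auto simp: lam_def vec_eq_iff)
    let ?V = "stack_rows r n (W S)"
    have "conformal_le ?V u"
    proof (subst conformal_le_iff_block_row[where r = r and n = n], goal_cases)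
      case 3
      have "min 0 (block_row n u j $ i) \<le> W S j i \<and> W S j i \<le> max 0 (block_row n u j $ i)"
        if "j < r" "i < n" for j i
        using Wconf[OF S that(2), of j] WI[OF that] by (simp only:)
      then show ?case by (simp add: conformal_le_def)
    qed (simp_all add: ud)
    then consider "?V = 0\<^sub>v (r * n)" | "?V = u"
      using umin ker[OF S] m(1) mS by blast
    then show "m = 0\<^sub>v ?N \<or> m = lam I"
    proof cases
      case 1
      have "W S j i = 0" if "j < r" "i < n" for j i
      proof -
        have "vec n (W S j) = 0\<^sub>v n" using 1 that(1) by (metis block_row_stack_rows block_row_zero)
        then show ?thesis using that(2) by (metis index_vec index_zero_vec(1))
      qed
      then have "S = {}" by (rule Wzero[OF S])
      then show ?thesis using lam0[OF S] mS by simp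
    next
      case 2
      \<comment> \<open>The selected summands already add up to \<open>u\<close>, so those left over
        have zero row sums and \<open>Wzero\<close> applies to them.\<close>
      have "W (I - S) j i = 0" if "j < r" "i < n" for j i
      proof -
        have "vec n (W S j) = block_row n u j" using 2 that(1) by (metis block_row_stack_rows)
        then have "W S j i = W I j i" using WI[OF that] index_vec[OF that(2)] by (metis (no_types))
        moreover have "W I j i = W (I - S) j i + W S j i"
        proof -
          have e: "{x. x \<in> I - S \<and> fst x = j} = {x. x \<in> I \<and> fst x = j} - {x. x \<in> S \<and> fst x = j}"
            by blast
          have "{x. x \<in> S \<and> fst x = j} \<subseteq> {x. x \<in> I \<and> fst x = j}" using S by blast
          moreover have "finite {x. x \<in> I \<and> fst x = j}" using finI by simp
          ultimately show ?thesis unfolding W_def e by (rule sum.subset_diff)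
        qed
        ultimately show ?thesis by simp
      qed
      then have "I - S = {}" by (rule Wzero[OF Diff_subset])
      then have "S = I" using S by blast
      then show ?thesis using mS by simp
    qed
  qed (rule lamI)
  moreover have "vec_type r n u \<le> one_norm (lam I)"
  proof -
    \<comment> \<open>A row without summands is an empty sum, so every nonzero row contributes a
      label.\<close>
    have "{j. j < r \<and> block_row n u j \<noteq> 0\<^sub>v n} \<subseteq> fst ` I"
    proof
      fix j assume "j \<in> {j. j < r \<and> block_row n u j \<noteq> 0\<^sub>v n}"
      then obtain i where j: "j < r" and i: "i < n" "block_row n u j $ i \<noteq> 0"
        by (auto simp: vec_eq_iff)
      then have "W I j i \<noteq> 0" using WI by simp
      then show "j \<in> fst ` I" unfolding W_def by (metis (mono_tags, lifting) imageI mem_Collect_eq sum.neutral)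
    qed
    then have "vec_type r n u \<le> card I"
      unfolding vec_type_def using finI card_image_le card_mono finite_imageI le_trans by metis
    \<comment> \<open>The entries of \<open>lam I\<close> are nonnegative, so its 1-norm is the sum
      of the fiber sizes.\<close>
    also have "int (card I) = (\<Sum>a<?N. int (card {x \<in> I. c x = a}))"
      using sum_card_fibers[OF finI, of c ?N "\<lambda>_. 1"] cS[of I] by simp
    then have "card I = one_norm (lam I)"
      by (simp add: one_norm_def lam_def flip: of_nat_sum)
    finally show ?thesis .
  qed
  ultimately show ?thesis by blast
qed

section \<open>Norms are attained as types\<close>

text \<open>Negation preserves the kernel and the conformal order, hence minimality. It is needed
  for rows that come from negative entries of a Graver element of the image matrix.\<close>

lemma graver_basis_uminus:
  assumes "v \<in> graver_basis M"
  shows "- v \<in> graver_basis M"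
proof -
  let ?n = "dim_col M"
  have v: "v \<in> mat_kernel M" "v \<noteq> 0\<^sub>v ?n" "v \<in> carrier_vec ?n"
    and vmin: "\<And>w. w \<in> mat_kernel M \<Longrightarrow> conformal_le w v \<Longrightarrow> w = 0\<^sub>v ?n \<or> w = v"
    using assms by (auto simp: graver_basis_iff mat_kernel_iff)
  have neg: "- w \<in> mat_kernel M" if "w \<in> mat_kernel M" for w
    using that by (auto simp: mat_kernel_iff sum_negf)
  have "w = 0\<^sub>v ?n \<or> w = - v" if w: "w \<in> mat_kernel M" "conformal_le w (- v)" for w
  proof -
    have wc: "w \<in> carrier_vec ?n" using w(1) by (simp add: mat_kernel_iff)
    have "min 0 (v $ i) \<le> (- w) $ i \<and> (- w) $ i \<le> max 0 (v $ i)" if "i < ?n" for i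
    proof -
      have "min 0 ((- v) $ i) \<le> w $ i \<and> w $ i \<le> max 0 ((- v) $ i)"
        using w(2) that v(3) by (simp add: conformal_le_def)
      then show ?thesis using that v(3) wc by simp linarith
    qed
    then have "conformal_le (- w) v" using wc v(3) by (simp add: conformal_le_def)
    then have "- w = 0\<^sub>v ?n \<or> - w = v" using vmin neg[OF w(1)] by blast
    then have "- (- w) = - 0\<^sub>v ?n \<or> - (- w) = - v" by metis
    then show ?thesis by simp
  qed
  moreover have "- v \<noteq> 0\<^sub>v ?n"
  proof
    assume "- v = 0\<^sub>v ?n"
    then have "- (- v) = - 0\<^sub>v ?n" by simp
    then show False using v(2) by simp
  qed
  ultimately show ?thesis using neg[OF v(1)] unfolding graver_basis_iff by blast
qed

lemma one_norm_mem_graver_types: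
  assumes n: "dim_col A = n" "dim_col B = n" and vs: "set vs = graver_basis A"
    and l: "l \<in> graver_basis (mult_cols B vs)"
  shows "one_norm l \<in> graver_types A B"
proof -
  let ?N = "length vs" and ?M = "mult_cols B vs"
  have lK: "l \<in> mat_kernel ?M" and l0: "l \<noteq> 0\<^sub>v ?N"
    and lmin: "\<And>m. m \<in> mat_kernel ?M \<Longrightarrow> conformal_le m l \<Longrightarrow> m = 0\<^sub>v ?N \<or> m = l"
    using l unfolding graver_basis_iff dim_mult_cols by blast+
  have ld: "dim_vec l = ?N" using lK unfolding mat_kernel_iff dim_mult_cols carrier_vec_def by blast
  have vsc: "set vs \<subseteq> carrier_vec n" using vs n by (auto simp: graver_basis_iff mat_kernel_iff)
  \<comment> \<open>\<open>I\<close> holds \<open>\<bar>l $ a\<bar>\<close> labelled copies of each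
    position \<open>a\<close>, and \<open>f\<close> numbers them as rows \<open>0\<close> to
    \<open>r - 1\<close>. Row \<open>j\<close> will be \<open>vs ! c j\<close> with the sign of
    \<open>l $ c j\<close>.\<close>
  define I where "I = (SIGMA a:{..<?N}. {..<nat \<bar>l $ a\<bar>})"
  define r where "r = card I"
  have finI: "finite I" by (simp add: I_def)
  have r: "r = one_norm l" by (simp add: r_def I_def one_norm_def ld)
  obtain f where f: "bij_betw f {..<r} I"
    using ex_bij_betw_nat_finite[OF finI] by (auto simp: r_def atLeast0LessThan)
  define c where "c j = fst (f j)" for j
  define t where "t a = sgn (l $ a)" for a
  define w where "w j i = t (c j) * vs ! c j $ i" for j i
  \<comment> \<open>The signed multiplicity vector of the rows in \<open>T\<close>; all rows
    together give back \<open>l\<close>.\<close>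
  define mu where "mu T = vec ?N (\<lambda>a. t a * int (card {j \<in> T. c j = a}))" for T
  have fI: "f j \<in> I" if "j < r" for j using f that by (auto simp: bij_betw_def)
  have c: "c j < ?N" "l $ c j \<noteq> 0" if "j < r" for j
    using fI[OF that] by (auto simp: I_def c_def)
  have cfib: "card {j \<in> {..<r}. c j = a} = nat \<bar>l $ a\<bar>" if a: "a < ?N" for a
  proof -
    have "f ` {j \<in> {..<r}. c j = a} = {x \<in> f ` {..<r}. fst x = a}"
      unfolding c_def by blast
    also have "\<dots> = {x \<in> I. fst x = a}" using f by (simp only: bij_betw_def)
    finally have image: "f ` {j \<in> {..<r}. c j = a} = {x \<in> I. fst x = a}" .
    have "inj_on f {j \<in> {..<r}. c j = a}"
      by (rule inj_on_subset[OF bij_betw_imp_inj_on[OF f]]) blast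
    then have "card {j \<in> {..<r}. c j = a} = card {x \<in> I. fst x = a}"
      unfolding image[symmetric] by (rule card_image[symmetric])
    also have "{x \<in> I. fst x = a} = {a} \<times> {..<nat \<bar>l $ a\<bar>}" using a by (auto simp: I_def)
    finally show ?thesis by (simp add: card_cartesian_product)
  qed
  have mul: "mu {..<r} = l"
    using cfib ld by (auto simp: mu_def t_def vec_eq_iff sgn_if)
  have wG: "vec n (w j) \<in> graver_basis A" if j: "j < r" for j
  proof -
    have v: "vs ! c j \<in> graver_basis A" using c(1)[OF j] vs nth_mem by blast
    then have d: "dim_vec (vs ! c j) = n" using n by (auto simp: graver_basis_iff mat_kernel_iff)
    consider "t (c j) = 1" | "t (c j) = - 1" using c(2)[OF j] unfolding t_def by (metis sgn_if)
    then show ?thesis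
    proof cases
      case 1
      then have "vec n (w j) = vs ! c j" using d by (simp add: vec_eq_iff w_def)
      then show ?thesis using v by simp
    next
      case 2
      then have "vec n (w j) = - (vs ! c j)" using d by (simp add: vec_eq_iff w_def)
      then show ?thesis using graver_basis_uminus[OF v] by simp
    qed
  qed
  have wK: "vec n (w j) \<in> mat_kernel A" and w0: "vec n (w j) \<noteq> 0\<^sub>v n" if "j < r" for j
    using wG[OF that] n by (auto simp: graver_basis_iff)
  have sumB: "(\<Sum>a<?N. ?M $$ (k, a) * mu T $ a) = (\<Sum>j\<in>T. \<Sum>i<n. B $$ (k, i) * w j i)"
    if T: "T \<subseteq> {..<r}" and k: "k < dim_row B" for T k
  proof -
    have "finite T" using T finite_subset by blast
    moreover have "c ` T \<subseteq> {..<?N}" using T c(1) by blast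
    ultimately show ?thesis using mult_cols_fibers[OF vsc n(2) k, of T c t] by (simp add: mu_def w_def)
  qed
  have "r \<noteq> 0"
  proof
    assume "r = 0"
    then have "mu {..<r} = 0\<^sub>v ?N" by (auto simp: mu_def)
    then show False using l0 mul by simp
  qed
  let ?L = "lawrence_lifting A B r" and ?U = "stack_rows r n w"
  have "?U \<in> graver_basis ?L"
    unfolding graver_basis_iff dim_lawrence_lifting n(1)
  proof (intro conjI ballI impI)
    have "(\<Sum>j<r. \<Sum>i<n. B $$ (k, i) * block_row n ?U j $ i) = 0" if k: "k < dim_row B" for k
    proof -
      have "(\<Sum>j<r. \<Sum>i<n. B $$ (k, i) * block_row n ?U j $ i) = (\<Sum>j<r. \<Sum>i<n. B $$ (k, i) * w j i)"
        by (intro sum.cong refl) (simp del: block_row_index)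
      also have "\<dots> = (\<Sum>a<?N. ?M $$ (k, a) * l $ a)" using sumB[OF order_refl k] mul by simp
      also have "\<dots> = 0" using lK k unfolding mat_kernel_iff dim_mult_cols by blast
      finally show ?thesis .
    qed
    moreover have "block_row n ?U j \<in> mat_kernel A" if "j < r" for j using wK[OF that] that by simp
    ultimately show "?U \<in> mat_kernel ?L"
      unfolding mat_kernel_lawrence_lifting_iff[OF n] by (blast intro: carrier_vecI dim_stack_rows)
    have j: "0 < r" using \<open>r \<noteq> 0\<close> by simp
    show "?U \<noteq> 0\<^sub>v (r * n)"
    proof
      assume "?U = 0\<^sub>v (r * n)"
      then have "block_row n ?U 0 = 0\<^sub>v n" using j by simp
      then show False using w0[OF j] j by simp
    qed
    fix v assume vK: "v \<in> mat_kernel ?L" and vU: "conformal_le v ?U"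
    have vA: "block_row n v j \<in> mat_kernel A" if "j < r" for j
      using vK that by (simp add: mat_kernel_lawrence_lifting_iff[OF n])
    have vB: "(\<Sum>j<r. \<Sum>i<n. B $$ (k, i) * block_row n v j $ i) = 0" if "k < dim_row B" for k
      using vK that unfolding mat_kernel_lawrence_lifting_iff[OF n] by blast
    have vd: "dim_vec v = r * n" using vU by (simp add: conformal_le_def)
    \<comment> \<open>Row \<open>j\<close> of \<open>?U\<close> is a Graver element of
      \<open>A\<close>, so a conformal part of the matrix can only keep or drop it as a
      whole.\<close>
    have vj: "block_row n v j = 0\<^sub>v n \<or> block_row n v j = vec n (w j)" if j: "j < r" for j
    proof -
      have "conformal_le (block_row n v j) (vec n (w j))"
        using vU j conformal_le_iff_block_row[OF vd, of ?U] by auto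
      then show ?thesis using wG[OF j] vA[OF j] n(1) unfolding graver_basis_iff by blast
    qed
    define T where "T = {j. j < r \<and> block_row n v j = vec n (w j)}"
    have T: "T \<subseteq> {..<r}" by (auto simp: T_def)
    have finT: "finite T" using T finite_subset by blast
    \<comment> \<open>The rows of \<open>v\<close> outside \<open>T\<close> are zero, so the
      \<open>B\<close> condition on \<open>v\<close> is a condition on the rows in \<open>T\<close>
      alone, which \<open>sumB\<close> turns into one on \<open>mu T\<close>.\<close>
    have muK: "mu T \<in> mat_kernel ?M"
      unfolding mat_kernel_iff dim_mult_cols
    proof (intro conjI allI impI)
      show "mu T \<in> carrier_vec ?N" by (simp add: mu_def)
      fix k assume k: "k < dim_row B"
      have "(\<Sum>j\<in>T. \<Sum>i<n. B $$ (k, i) * w j i) = (\<Sum>j<r. \<Sum>i<n. B $$ (k, i) * block_row n v j $ i)"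
      proof (rule sum.mono_neutral_cong_left)
        show "\<forall>j\<in>{..<r} - T. (\<Sum>i<n. B $$ (k, i) * block_row n v j $ i) = 0"
        proof
          fix j assume "j \<in> {..<r} - T"
          then have "block_row n v j = 0\<^sub>v n" using vj[of j] by (auto simp: T_def)
          then show "(\<Sum>i<n. B $$ (k, i) * block_row n v j $ i) = 0"
            by (simp del: block_row_index)
        qed
        fix j assume "j \<in> T"
        then have "block_row n v j = vec n (w j)" by (simp add: T_def)
        then show "(\<Sum>i<n. B $$ (k, i) * w j i) = (\<Sum>i<n. B $$ (k, i) * block_row n v j $ i)"
          by (simp del: block_row_index)
      qed (use T in simp_all)
      then show "(\<Sum>a<?N. ?M $$ (k, a) * mu T $ a) = 0" using sumB[OF T k] vB[OF k] by simp
    qed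
    \<comment> \<open>A fiber within \<open>T\<close> has at most \<open>\<bar>l $ a\<bar>\<close>
      rows, and \<open>t a\<close> is the sign of \<open>l $ a\<close>.\<close>
    have "conformal_le (mu T) l"
      unfolding conformal_le_def
    proof (intro conjI allI impI)
      show "dim_vec (mu T) = dim_vec l" by (simp add: mu_def ld)
      fix a assume "a < dim_vec l"
      then have a: "a < ?N" by (simp add: ld)
      have "card {j \<in> T. c j = a} \<le> card {j \<in> {..<r}. c j = a}" using T by (intro card_mono) auto
      then have "int (card {j \<in> T. c j = a}) \<le> \<bar>l $ a\<bar>" using cfib[OF a] by simp
      then show "min 0 (l $ a) \<le> mu T $ a" "mu T $ a \<le> max 0 (l $ a)"
        using a by (auto simp: mu_def t_def sgn_if)
    qed
    then consider "mu T = 0\<^sub>v ?N" | "mu T = l" using lmin muK by blast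
    then show "v = 0\<^sub>v (r * n) \<or> v = ?U"
    proof cases
      case 1
      \<comment> \<open>The sign depends only on the position in \<open>vs\<close>, so rows of
        \<open>T\<close> with the same position cannot cancel in \<open>mu T\<close>; a member of
        \<open>T\<close> would leave a nonzero entry.\<close>
      have "j \<notin> T" for j
      proof
        assume j: "j \<in> T"
        then have cj: "c j < ?N" "t (c j) \<noteq> 0" using c T by (auto simp: t_def sgn_if)
        have "mu T $ c j = 0" using 1 cj by simp
        then have "card {i \<in> T. c i = c j} = 0" using cj by (simp add: mu_def)
        then show False using j finT by auto
      qed
      then have "block_row n v j = 0\<^sub>v n" if "j < r" for j using vj[OF that] that by (auto simp: T_def)
      then have "v = 0\<^sub>v (r * n)" using vec_eq_iff_block_row[OF vd, of "0\<^sub>v (r * n)"] by simp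
      then show ?thesis ..
    next
      case 2
      \<comment> \<open>Equal entries with a nonzero sign mean that the fiber of \<open>c j\<close>
        within \<open>T\<close> is as large as the full fiber, hence equal to it.\<close>
      have "j \<in> T" if j: "j < r" for j
      proof -
        have cj: "c j < ?N" "t (c j) \<noteq> 0" using c[OF j] by (auto simp: t_def sgn_if)
        have "mu T $ c j = mu {..<r} $ c j" using 2 mul by simp
        then have "card {i \<in> T. c i = c j} = card {i \<in> {..<r}. c i = c j}"
          using cj by (simp add: mu_def)
        moreover have "{i \<in> T. c i = c j} \<subseteq> {i \<in> {..<r}. c i = c j}" using T by blast
        ultimately have "{i \<in> T. c i = c j} = {i \<in> {..<r}. c i = c j}"
          by (intro card_subset_eq) simp_all
        then show ?thesis using j by blast
      qed
      then have "block_row n v j = block_row n ?U j" if "j < r" for j using that by (simp add: T_def)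
      then have "v = ?U" using vec_eq_iff_block_row[OF vd, of ?U] by simp
      then show ?thesis ..
    qed
  qed
  moreover have "vec_type r n ?U = r"
  proof -
    have "{j. j < r \<and> block_row n ?U j \<noteq> 0\<^sub>v n} = {..<r}" using w0 by auto
    then show ?thesis by (simp add: vec_type_def)
  qed
  moreover have "r \<ge> 1" using \<open>r \<noteq> 0\<close> by simp
  ultimately show ?thesis
    unfolding graver_types_def n(1) r[symmetric] mem_Collect_eq by metis
qed

section \<open>Comparison of the two suprema\<close>

theorem theorem3p5:
  fixes A B :: "int mat" and d n p :: nat and vs :: "int vec list"
  assumes "A \<in> carrier_mat d n"
    and "B \<in> carrier_mat p n"
    and "distinct vs" and "set vs = graver_basis A"
  shows "finite (graver_types A B) \<and>
    graver_complexity A B = Sup (one_norm ` graver_basis (mult_cols B vs))"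
proof -
  have n: "dim_col A = n" "dim_col B = n" using assms(1,2) by auto
  let ?X = "graver_types A B" and ?Y = "one_norm ` graver_basis (mult_cols B vs)"
  have le: "\<exists>y \<in> ?Y. x \<le> y" if "x \<in> ?X" for x
    using that graver_type_le_one_norm[OF n assms(4)] unfolding graver_types_def n(1) by blast
  have sub: "?Y \<subseteq> ?X" using one_norm_mem_graver_types[OF n assms(4)] by blast
  have finY: "finite ?Y" using finite_graver_basis by blast
  \<comment> \<open>An element of \<open>?X\<close> is dominated by one of \<open>?Y\<close>, so
    \<open>?Y\<close> is nonempty whenever its maximum is used.\<close>
  have "x \<le> Max ?Y" if "x \<in> ?X" for x using le[OF that] finY Max_ge le_trans by blast
  then have finX: "finite ?X" using finite_nat_set_iff_bounded_le by blast
  have "Sup ?X = Sup ?Y"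
  \<comment> \<open>An empty \<open>?X\<close> leaves \<open>?Y\<close> empty as well, by inclusion.
    Otherwise domination gives one inequality and inclusion the other.\<close>
  proof (cases "?X = {}")
    case True
    then show ?thesis using sub by simp
  next
    case False
    then have "?Y \<noteq> {}" using le by blast
    moreover have "bdd_above ?X" "bdd_above ?Y" using finX finY by simp_all
    ultimately show ?thesis using False le sub
      by (intro antisym cSup_mono cSup_subset_mono)
  qed
  then show ?thesis using finX by (simp add: graver_complexity_def)
qed

end
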